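(* Let $m,n\ge 0$ be integers and let $T_{m,n}$ be the square torus grid of dimension $(4m+2)\times(4n+2)$, i.e. the set of cells $\mathbb{Z}/(4m+2)\mathbb{Z}\times\mathbb{Z}/(4n+2)\mathbb{Z}$. Then $T_{m,n}$ cannot be tiled by T-tetrominoes.
   Context: The T-tetromino is the polyomino $\{(0,0),(0,1),(0,2),(1,1)\}\subset\mathbb{Z}^2$ (three unit squares in a row with a fourth square attached to the middle one). A placement of a polyomino $P\subset\mathbb{Z}^2$ on the torus grid is the image of $g(P)+v$ under the reduction map $\mathbb{Z}^2\to\mathbb{Z}/(4m+2)\mathbb{Z}\times\mathbb{Z}/(4n+2)\mathbb{Z}$, where $g$ is a rotation or reflection of the square lattice (an element of the dihedral group of order 8 acting on $\mathbb{Z}^2$) and $v\in\mathbb{Z}^2$, provided that this image consists of $|P|$ distinct cells. A tiling of the torus grid by a polyomino is a collection of placements of that polyomino whose cell sets partition the set of all cells. *)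

theory Defs
  imports Main "HOL-Library.Disjoint_Sets"
begin

type_synonym cell = "int \<times> int"

text \<open>The torus grid \<open>\<int>/a\<int> \<times> \<int>/b\<int>\<close>, with each residue class represented by its least
  nonnegative element (meaningful for \<open>a, b > 0\<close>).\<close>

definition torus_grid :: "int \<Rightarrow> int \<Rightarrow> cell set" where
  "torus_grid a b = {0..<a} \<times> {0..<b}"

definition torus_reduce :: "int \<Rightarrow> int \<Rightarrow> cell \<Rightarrow> cell" where
  "torus_reduce a b = (\<lambda>(x, y). (x mod a, y mod b))"

definition lattice_rot :: "cell \<Rightarrow> cell" where
  "lattice_rot = (\<lambda>(x, y). (- y, x))"

definition lattice_refl :: "cell \<Rightarrow> cell" where
  "lattice_refl = (\<lambda>(x, y). (x, - y))"

definition lattice_dihedral :: "(cell \<Rightarrow> cell) set" where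
  "lattice_dihedral = {(lattice_rot ^^ i) \<circ> (lattice_refl ^^ j) | i j. i < 4 \<and> j < 2}"

definition lattice_translate :: "cell \<Rightarrow> cell \<Rightarrow> cell" where
  "lattice_translate = (\<lambda>(u, v) (x, y). (x + u, y + v))"

definition torus_placements :: "int \<Rightarrow> int \<Rightarrow> cell set \<Rightarrow> cell set set" where
  "torus_placements a b P =
    {Q. \<exists>g \<in> lattice_dihedral. \<exists>v.
       Q = torus_reduce a b ` lattice_translate v ` g ` P \<and> card Q = card P}"

definition torus_tiling :: "int \<Rightarrow> int \<Rightarrow> cell set \<Rightarrow> cell set set \<Rightarrow> bool" where
  "torus_tiling a b P C \<longleftrightarrow>
     C \<subseteq> torus_placements a b P \<and> partition_on (torus_grid a b) C"

definition T_tetromino :: "cell set" where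
  "T_tetromino = {(0, 0), (0, 1), (0, 2), (1, 1)}"

end

theory Submission
  imports Defs
begin

text \<open>Both side lengths are even, so the checkerboard colouring of the plane descends to the torus
  and splits its cells evenly. Giving the two colours the values \<open>1\<close> and \<open>-1\<close>, the torus has sum
  \<open>0\<close>, while all placements of a polyomino have the same sum up to sign. If that sum is nonzero, as
  it is for the T-tetromino, then the two signs occur equally often and the number of tiles is even.
  But a tiling by T-tetrominoes has \<open>(2m + 1)(2n + 1)\<close> tiles.\<close>

lemma finite_torus_grid: "finite (torus_grid a b)"
  by (simp add: torus_grid_def)

lemma card_torus_grid: "card (torus_grid a b) = nat a * nat b"
  by (simp add: torus_grid_def card_cartesian_product)

lemma card_torus_placement:
  assumes "Q \<in> torus_placements a b P"
  shows "card Q = card P"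
  using assms by (auto simp: torus_placements_def)

lemma torus_placement_eq_image:
  assumes "Q \<in> torus_placements a b P" "finite P"
  obtains g v where "g \<in> lattice_dihedral"
    and "Q = (\<lambda>c. torus_reduce a b (lattice_translate v (g c))) ` P"
    and "inj_on (\<lambda>c. torus_reduce a b (lattice_translate v (g c))) P"
proof -
  obtain g v where "g \<in> lattice_dihedral"
    and Q: "Q = (\<lambda>c. torus_reduce a b (lattice_translate v (g c))) ` P"
    using assms(1) by (auto simp: torus_placements_def image_image)
  then show thesis
    using that card_torus_placement[OF assms(1)] assms(2) by (simp add: eq_card_imp_inj_on)
qed

lemma sum_torus_tiling:
  fixes f :: "cell \<Rightarrow> 'a::comm_monoid_add"
  assumes "torus_tiling a b P C"
  shows "(\<Sum>Q\<in>C. sum f Q) = sum f (torus_grid a b)"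
  using assms by (auto simp: torus_tiling_def sum.partition[OF finite_torus_grid, of a b C])

lemma finite_torus_tiling:
  assumes "torus_tiling a b P C"
  shows "finite C"
  using assms finite_elements[OF finite_torus_grid] by (auto simp: torus_tiling_def)

lemma card_torus_tiling:
  assumes "torus_tiling a b P C"
  shows "card C * card P = nat a * nat b"
proof -
  have "card Q = card P" if "Q \<in> C" for Q
    using that assms card_torus_placement by (auto simp: torus_tiling_def)
  then have "card C * card P = (\<Sum>Q\<in>C. \<Sum>c\<in>Q. 1)"
    by simp
  also have "\<dots> = card (torus_grid a b)"
    by (simp only: sum_torus_tiling[OF assms] card_eq_sum)
  finally show ?thesis
    by (simp add: card_torus_grid)
qed

definition checkerboard :: "cell \<Rightarrow> int" where
  "checkerboard = (\<lambda>(x, y). if even (x + y) then 1 else - 1)"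

lemma odd_checkerboard: "odd (checkerboard c)"
  by (simp add: checkerboard_def split: prod.split)

lemma checkerboard_torus_reduce:
  assumes "even a" "even b"
  shows "checkerboard (torus_reduce a b c) = checkerboard c"
  using assms by (auto simp: checkerboard_def torus_reduce_def dvd_mod_iff split: prod.splits)

lemma checkerboard_lattice_translate:
  "checkerboard (lattice_translate v c) = checkerboard v * checkerboard c"
  by (auto simp: checkerboard_def lattice_translate_def split: prod.splits)

lemma checkerboard_lattice_dihedral:
  assumes "g \<in> lattice_dihedral"
  shows "checkerboard (g c) = checkerboard c"
proof -
  have rot: "checkerboard ((lattice_rot ^^ i) c) = checkerboard c" for i c
    by (induction i) (auto simp: checkerboard_def lattice_rot_def split: prod.splits)
  have refl: "checkerboard ((lattice_refl ^^ j) c) = checkerboard c" for j c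
    by (induction j) (auto simp: checkerboard_def lattice_refl_def split: prod.splits)
  show ?thesis
    using assms by (auto simp: lattice_dihedral_def rot refl)
qed

lemma sum_checkerboard_torus_placement:
  assumes "even a" "even b" "finite P" "Q \<in> torus_placements a b P"
  obtains v where "sum checkerboard Q = checkerboard v * sum checkerboard P"
proof -
  obtain g v where g: "g \<in> lattice_dihedral"
    and Q: "Q = (\<lambda>c. torus_reduce a b (lattice_translate v (g c))) ` P"
    and inj: "inj_on (\<lambda>c. torus_reduce a b (lattice_translate v (g c))) P"
    using torus_placement_eq_image[OF assms(4,3)] .
  have "sum checkerboard Q = (\<Sum>c\<in>P. checkerboard (torus_reduce a b (lattice_translate v (g c))))"
    by (simp add: Q sum.reindex[OF inj])
  also have "\<dots> = (\<Sum>c\<in>P. checkerboard v * checkerboard c)"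
    by (simp add: checkerboard_torus_reduce[OF assms(1,2)] checkerboard_lattice_translate
        checkerboard_lattice_dihedral[OF g])
  finally show thesis
    using that by (simp add: sum_distrib_left)
qed

lemma sum_checkerboard_torus_grid:
  assumes "even b"
  shows "sum checkerboard (torus_grid a b) = 0"
proof -
  define swap :: "cell \<Rightarrow> cell"
    where "swap = (\<lambda>(x, y). (x, if even y then y + 1 else y - 1))"
  show ?thesis
  proof (rule sum_involution_eq_0)
    fix c assume "c \<in> torus_grid a b"
    then obtain x y where c: "c = (x, y)" "0 \<le> x" "x < a" "0 \<le> y" "y < b"
      by (auto simp: torus_grid_def)
    show "checkerboard (swap c) + checkerboard c = 0" "swap (swap c) = c" "swap c \<noteq> c"
      by (simp_all add: c(1) swap_def checkerboard_def)
    have "y + 1 < b" if "even y"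
      using that c(5) assms by presburger
    moreover have "0 \<le> y - 1" if "odd y"
      using that c(4) by presburger
    ultimately show "swap c \<in> torus_grid a b"
      using c by (simp add: swap_def torus_grid_def)
  qed
qed

lemma even_card_torus_tiling:
  assumes "even a" "even b" "torus_tiling a b P C" "sum checkerboard P \<noteq> 0"
  shows "even (card C)"
proof -
  have "finite P"
    using assms(4) sum.infinite by blast
  have "\<exists>v. sum checkerboard Q = checkerboard v * sum checkerboard P" if "Q \<in> C" for Q
    using sum_checkerboard_torus_placement[OF assms(1,2) \<open>finite P\<close>] that assms(3)
    by (metis torus_tiling_def subsetD)
  then obtain v where
    v: "sum checkerboard Q = checkerboard (v Q) * sum checkerboard P" if "Q \<in> C" for Q
    by metis
  have "(\<Sum>Q\<in>C. checkerboard (v Q)) * sum checkerboard P = (\<Sum>Q\<in>C. sum checkerboard Q)"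
    by (simp add: v sum_distrib_right)
  also have "\<dots> = 0"
    by (simp add: sum_torus_tiling[OF assms(3)] sum_checkerboard_torus_grid[OF assms(2)])
  finally have "(\<Sum>Q\<in>C. checkerboard (v Q)) = 0"
    using assms(4) by simp
  then have "even (\<Sum>Q\<in>C. checkerboard (v Q))"
    by simp
  then show ?thesis
    by (simp add: even_sum_iff[OF finite_torus_tiling[OF assms(3)]] odd_checkerboard)
qed

lemma sum_checkerboard_T_tetromino: "sum checkerboard T_tetromino = 2"
  by (simp add: T_tetromino_def checkerboard_def)

lemma card_T_tetromino: "card T_tetromino = 4"
  by (simp add: T_tetromino_def)

theorem theorem3p2:
  fixes m n :: nat
  shows "\<not> (\<exists>C. torus_tiling (4 * int m + 2) (4 * int n + 2) T_tetromino C)"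
proof
  assume "\<exists>C. torus_tiling (4 * int m + 2) (4 * int n + 2) T_tetromino C"
  then obtain C where tiling: "torus_tiling (4 * int m + 2) (4 * int n + 2) T_tetromino C" ..
  have "even (card C)"
    by (rule even_card_torus_tiling[OF _ _ tiling]) (simp_all add: sum_checkerboard_T_tetromino)
  moreover have "card C * 4 = (4 * m + 2) * (4 * n + 2)"
    using card_torus_tiling[OF tiling]
    by (simp add: card_T_tetromino nat_add_distrib nat_mult_distrib)
  then have "card C = (2 * m + 1) * (2 * n + 1)"
    by (simp add: algebra_simps)
  ultimately show False
    by simp
qed

end
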